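(* Let $R$ be a valuation ring and let $N$ be the nilradical of $R$. Then $R$ is maximal if and only if $R/N$ and $R_N$ are maximal.
   Context: All rings are commutative with unity. A valuation ring is a ring whose ideals are linearly ordered by inclusion (zero divisors are allowed); its nilradical $N$ is a prime ideal, and $R_N$ is the localization of $R$ at $N$. A valuation ring $R$ is maximal if it is linearly compact in the discrete topology, i.e. every family $(x_i+A_i)_{i\in I}$ of cosets of ideals of $R$ with the finite intersection property has a non-empty intersection. *)

theory Defs
  imports "HOL-Algebra.Algebra"
begin

text \<open>
  Valuation rings may have zero divisors. They are required to be nontrivial: only then is the
  nilradical a prime ideal, and the complement of the nilradical a multiplicative set.
\<close>

locale valuation_ring = cring R for R (structure) +
  assumes one_not_zero: "\<one> \<noteq> \<zero>"
    and ideals_linear: "\<lbrakk>ideal I R; ideal J R\<rbrakk> \<Longrightarrow> I \<subseteq> J \<or> J \<subseteq> I"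

text \<open>
  A family of cosets enters only through its set \<open>\<C>\<close> of members, since the (finite) intersections
  of a family depend on nothing else. Intersecting with the carrier matters only for the empty
  family, whose intersection is the whole ring.
\<close>

definition linearly_compact :: "('a, 'm) ring_scheme \<Rightarrow> bool" where
  "linearly_compact R \<longleftrightarrow>
    (\<forall>\<C>. (\<forall>C\<in>\<C>. \<exists>x A. x \<in> carrier R \<and> ideal A R \<and> C = A +>\<^bsub>R\<^esub> x) \<longrightarrow>
         (\<forall>\<F>. finite \<F> \<and> \<F> \<subseteq> \<C> \<longrightarrow> carrier R \<inter> \<Inter>\<F> \<noteq> {}) \<longrightarrow>
         carrier R \<inter> \<Inter>\<C> \<noteq> {})"

locale maximal_valuation_ring = valuation_ring R for R (structure) +
  assumes linearly_compact: "linearly_compact R"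

definition nilradical :: "('a, 'm) ring_scheme \<Rightarrow> 'a set" where
  "nilradical R = {x \<in> carrier R. \<exists>n::nat. x [^]\<^bsub>R\<^esub> n = \<zero>\<^bsub>R\<^esub>}"

text \<open>
  The fraction \<open>a/s\<close> is the class of all pairs \<open>(b, t)\<close> with \<open>u (a t - b s) = 0\<close> for some \<open>u\<close> in \<open>S\<close>.
  Sums and products of classes are formed from all representatives at once; as the equivalence is
  compatible with the usual formulas, these unions are unions of one and the same class.
\<close>

definition fraction :: "('a, 'm) ring_scheme \<Rightarrow> 'a set \<Rightarrow> 'a \<Rightarrow> 'a \<Rightarrow> ('a \<times> 'a) set" where
  "fraction R S a s =
    {(b, t) \<in> carrier R \<times> S.
       \<exists>u\<in>S. u \<otimes>\<^bsub>R\<^esub> (a \<otimes>\<^bsub>R\<^esub> t \<ominus>\<^bsub>R\<^esub> b \<otimes>\<^bsub>R\<^esub> s) = \<zero>\<^bsub>R\<^esub>}"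

definition localization :: "('a, 'm) ring_scheme \<Rightarrow> 'a set \<Rightarrow> ('a \<times> 'a) set ring" where
  "localization R S =
    \<lparr>carrier = {fraction R S a s | a s. a \<in> carrier R \<and> s \<in> S},
     monoid.mult = (\<lambda>p q. \<Union>(a, s)\<in>p. \<Union>(b, t)\<in>q. fraction R S (a \<otimes>\<^bsub>R\<^esub> b) (s \<otimes>\<^bsub>R\<^esub> t)),
     monoid.one = fraction R S \<one>\<^bsub>R\<^esub> \<one>\<^bsub>R\<^esub>,
     ring.zero = fraction R S \<zero>\<^bsub>R\<^esub> \<one>\<^bsub>R\<^esub>,
     ring.add = (\<lambda>p q. \<Union>(a, s)\<in>p. \<Union>(b, t)\<in>q.
              fraction R S (a \<otimes>\<^bsub>R\<^esub> t \<oplus>\<^bsub>R\<^esub> b \<otimes>\<^bsub>R\<^esub> s) (s \<otimes>\<^bsub>R\<^esub> t))\<rparr>"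

definition localization_at :: "('a, 'm) ring_scheme \<Rightarrow> 'a set \<Rightarrow> ('a \<times> 'a) set ring" where
  "localization_at R P = localization R (carrier R - P)"

end

theory Submission
  imports Defs
begin

text \<open>
  The equivalence holds for every prime ideal \<open>P\<close> of a valuation ring \<open>R\<close>, and the nilradical is prime
  because any two elements are comparable, so that the square of one of them is a multiple of their
  product.

  Everything rests on one property that the canonical homomorphisms \<open>f\<close> from \<open>R\<close> to \<open>R/P\<close> and to
  \<open>R\<^sub>P\<close> share: each proper ideal of the target lies in the image of \<open>f\<close>. For \<open>R/P\<close> this is
  surjectivity. For \<open>R\<^sub>P\<close>, a proper ideal consists of fractions \<open>a/s\<close> with \<open>a \<in> P\<close>; as \<open>s \<notin> P\<close>, the
  ideal generated by \<open>s\<close> contains \<open>P\<close>, so \<open>a = s b\<close> and \<open>a/s = b/1\<close>. For such an \<open>f\<close>,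
  linear compactness of \<open>R\<close> passes to the target, and linear compactness of the target gives that of
  \<open>R\<close> for cosets of contracted ideals. From \<open>R\<close> to the target: if \<open>x\<^sub>0 + A\<^sub>0\<close> is a coset of the family with
  \<open>A\<^sub>0\<close> proper, all intersections with it lie in \<open>x\<^sub>0 + f(R)\<close>, so the family can be pulled back along
  \<open>r \<mapsto> x\<^sub>0 + f(r)\<close> (\<open>linearly_compact_codomain\<close>). In the other direction, a common point of the
  extended cosets differs from some \<open>f(x\<^sub>0)\<close> by an element of a proper ideal, so it is in the image
  (\<open>linearly_compact_wrt_contractions\<close>).

  It remains to obtain linear compactness of \<open>R\<close> from two kinds of ideals: those containing \<open>P\<close>
  (contracted from \<open>R/P\<close>) and those saturated with respect to the complement of \<open>P\<close> (contracted from
  \<open>R\<^sub>P\<close>). Given cosets \<open>x\<^sub>i + A\<^sub>i\<close>, either every \<open>A\<^sub>i\<close> contains the saturation of some \<open>A\<^sub>j\<close>, and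
  then the cosets of the saturations do the job; or some \<open>A\<^sub>0\<close> contains no such saturation, and then
  there is a \<open>z\<close> with \<open>A\<^sub>0 \<subseteq> R z\<close> and \<open>P z \<subseteq> A\<^sub>i\<close> for all \<open>i\<close>, so that the intersection can be found
  in the cyclic \<open>R/P\<close>-module \<open>R z / P z\<close> (\<open>linearly_compact_if_above_and_saturated\<close>).
\<close>

section \<open>Linear compactness with respect to a family of ideals\<close>

text \<open>
  Only cosets of ideals in \<open>\<I>\<close> are tested. This lets the linear compactness of \<open>R/P\<close> and of \<open>R\<^sub>P\<close> be
  expressed inside \<open>R\<close>.
\<close>

definition linearly_compact_wrt :: "('a, 'm) ring_scheme \<Rightarrow> 'a set set \<Rightarrow> bool" where
  "linearly_compact_wrt R \<I> \<longleftrightarrow>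
    (\<forall>\<C>. (\<forall>C\<in>\<C>. \<exists>x A. x \<in> carrier R \<and> A \<in> \<I> \<and> C = A +>\<^bsub>R\<^esub> x) \<longrightarrow>
         (\<forall>\<F>. finite \<F> \<and> \<F> \<subseteq> \<C> \<longrightarrow> carrier R \<inter> \<Inter>\<F> \<noteq> {}) \<longrightarrow>
         carrier R \<inter> \<Inter>\<C> \<noteq> {})"

lemma linearly_compact_iff: "linearly_compact R \<longleftrightarrow> linearly_compact_wrt R {A. ideal A R}"
  by (simp add: linearly_compact_def linearly_compact_wrt_def)

lemma linearly_compact_wrtD:
  assumes "linearly_compact_wrt R \<I>"
    and "\<And>C. C \<in> \<C> \<Longrightarrow> \<exists>x A. x \<in> carrier R \<and> A \<in> \<I> \<and> C = A +>\<^bsub>R\<^esub> x"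
    and "\<And>\<F>. finite \<F> \<Longrightarrow> \<F> \<subseteq> \<C> \<Longrightarrow> \<exists>r\<in>carrier R. \<forall>C\<in>\<F>. r \<in> C"
  shows "\<exists>r\<in>carrier R. \<forall>C\<in>\<C>. r \<in> C"
proof -
  have "carrier R \<inter> \<Inter>\<C> \<noteq> {}"
  proof (rule assms(1)[unfolded linearly_compact_wrt_def, rule_format])
    show "\<exists>x A. x \<in> carrier R \<and> A \<in> \<I> \<and> C = A +>\<^bsub>R\<^esub> x" if "C \<in> \<C>" for C
      using assms(2)[OF that] .
    show "carrier R \<inter> \<Inter>\<F> \<noteq> {}" if "finite \<F> \<and> \<F> \<subseteq> \<C>" for \<F>
      using assms(3)[of \<F>] that by blast
  qed
  then show ?thesis by blast
qed

text \<open>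
  The centre and the ideal come as functions of the coset, so that proofs about a family of cosets
  can refer to them without making choices.
\<close>

lemma linearly_compact_wrtI:
  assumes "\<And>\<C> x A. \<lbrakk>\<And>C. C \<in> \<C> \<Longrightarrow> x C \<in> carrier R \<and> A C \<in> \<I> \<and> C = A C +>\<^bsub>R\<^esub> x C;
      \<And>\<F>. finite \<F> \<Longrightarrow> \<F> \<subseteq> \<C> \<Longrightarrow> \<exists>r\<in>carrier R. \<forall>C\<in>\<F>. r \<in> C\<rbrakk>
    \<Longrightarrow> \<exists>r\<in>carrier R. \<forall>C\<in>\<C>. r \<in> C"
  shows "linearly_compact_wrt R \<I>"
  unfolding linearly_compact_wrt_def
proof (intro allI impI)
  fix \<C>
  assume cosets: "\<forall>C\<in>\<C>. \<exists>x A. x \<in> carrier R \<and> A \<in> \<I> \<and> C = A +>\<^bsub>R\<^esub> x"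
    and fip: "\<forall>\<F>. finite \<F> \<and> \<F> \<subseteq> \<C> \<longrightarrow> carrier R \<inter> \<Inter>\<F> \<noteq> {}"
  obtain x where "\<forall>C\<in>\<C>. \<exists>A. x C \<in> carrier R \<and> A \<in> \<I> \<and> C = A +>\<^bsub>R\<^esub> x C"
    using bchoice[OF cosets] by blast
  then obtain A where "\<forall>C\<in>\<C>. x C \<in> carrier R \<and> A C \<in> \<I> \<and> C = A C +>\<^bsub>R\<^esub> x C"
    by metis
  moreover have "\<exists>r\<in>carrier R. \<forall>C\<in>\<F>. r \<in> C" if "finite \<F>" "\<F> \<subseteq> \<C>" for \<F>
    using fip[rule_format, OF conjI[OF that]] by blast
  ultimately have "\<exists>r\<in>carrier R. \<forall>C\<in>\<C>. r \<in> C"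
    by (intro assms[of \<C> x A]) simp_all
  then show "carrier R \<inter> \<Inter>\<C> \<noteq> {}" by blast
qed

lemma linearly_compact_wrt_subset:
  assumes "linearly_compact_wrt R \<I>" "\<J> \<subseteq> \<I>"
  shows "linearly_compact_wrt R \<J>"
proof (rule linearly_compact_wrtI)
  fix \<C> x A
  assume cosets: "\<And>C. C \<in> \<C> \<Longrightarrow> x C \<in> carrier R \<and> A C \<in> \<J> \<and> C = A C +>\<^bsub>R\<^esub> x C"
    and fip: "\<And>\<F>. finite \<F> \<Longrightarrow> \<F> \<subseteq> \<C> \<Longrightarrow> \<exists>r\<in>carrier R. \<forall>C\<in>\<F>. r \<in> C"
  show "\<exists>r\<in>carrier R. \<forall>C\<in>\<C>. r \<in> C"
  proof (rule linearly_compact_wrtD[OF assms(1) _ fip])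
    show "\<exists>x A. x \<in> carrier R \<and> A \<in> \<I> \<and> C = A +>\<^bsub>R\<^esub> x" if "C \<in> \<C>" for C
      using cosets[OF that] assms(2) by (meson subsetD)
  qed
qed

lemma (in ideal) mem_coset_iff:
  assumes "x \<in> carrier R"
  shows "z \<in> I +> x \<longleftrightarrow> z \<in> carrier R \<and> z \<ominus> x \<in> I"
proof
  assume "z \<in> I +> x"
  then obtain a where a: "a \<in> I" "z = a \<oplus> x"
    by (auto simp: a_r_coset_def')
  moreover have "a \<in> carrier R" using a by auto
  moreover have "a \<oplus> x \<ominus> x = a" using assms \<open>a \<in> carrier R\<close> by algebra
  ultimately show "z \<in> carrier R \<and> z \<ominus> x \<in> I" using assms by simp
next
  assume z: "z \<in> carrier R \<and> z \<ominus> x \<in> I"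
  moreover have "z = (z \<ominus> x) \<oplus> x" using assms z by algebra
  ultimately show "z \<in> I +> x" unfolding a_r_coset_def' by blast
qed

lemma (in ideal) diff_trans:
  assumes "a \<ominus> b \<in> I" "b \<ominus> c \<in> I" "a \<in> carrier R" "b \<in> carrier R" "c \<in> carrier R"
  shows "a \<ominus> c \<in> I"
proof -
  have "a \<ominus> c = (a \<ominus> b) \<oplus> (b \<ominus> c)" using assms(3-5) by algebra
  then show ?thesis using assms(1,2) by simp
qed

lemma (in ideal) diff_sym:
  assumes "a \<ominus> b \<in> I" "a \<in> carrier R" "b \<in> carrier R"
  shows "b \<ominus> a \<in> I"
proof -
  have "b \<ominus> a = \<ominus> (a \<ominus> b)" using assms(2,3) by algebra
  then show ?thesis using assms(1) by simp
qed

lemma (in cring) ideal_colon: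
  assumes "ideal A R" "z \<in> carrier R"
  shows "ideal {r \<in> carrier R. r \<otimes> z \<in> A} R"
proof -
  interpret A: ideal A R by fact
  show ?thesis
  proof (rule idealI[OF ring_axioms])
    show "subgroup {r \<in> carrier R. r \<otimes> z \<in> A} (add_monoid R)"
    proof (rule add.subgroupI)
      have "\<zero> \<in> {r \<in> carrier R. r \<otimes> z \<in> A}" using assms(2) by simp
      then show "{r \<in> carrier R. r \<otimes> z \<in> A} \<noteq> {}" by blast
    qed (use assms(2) in \<open>auto simp: l_distr l_minus\<close>)
    fix a x assume a: "a \<in> {r \<in> carrier R. r \<otimes> z \<in> A}" and x: "x \<in> carrier R"
    then have "x \<otimes> a \<otimes> z \<in> A" using A.I_l_closed assms(2) by (simp add: m_assoc)
    then show "x \<otimes> a \<in> {r \<in> carrier R. r \<otimes> z \<in> A}"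
      and "a \<otimes> x \<in> {r \<in> carrier R. r \<otimes> z \<in> A}"
      using a x by (simp_all add: m_comm)
  qed
qed

text \<open>
  If every preimage under \<open>f\<close> of a coset from \<open>\<C>\<close> is a coset of an ideal from \<open>\<I>\<close>, then the
  family of preimages can be intersected in \<open>R\<close>. The map \<open>f\<close> is typically affine rather than a homomorphism:
  only the differences of its values matter. The finite intersections must meet the image of \<open>f\<close>
  because their preimages have to be nonempty.
\<close>

lemma linearly_compact_wrt_pullback:
  fixes R (structure) and L (structure)
  assumes rings: "ring R" "ring L"
    and lc: "linearly_compact_wrt R \<I>" and ideals: "\<And>B. B \<in> \<I> \<Longrightarrow> ideal B R"
    and f: "\<And>r. r \<in> carrier R \<Longrightarrow> f r \<in> carrier L"
    and cosets: "\<And>C. C \<in> \<C> \<Longrightarrow> \<exists>y A B. y \<in> carrier L \<and> ideal A L \<and> C = A +>\<^bsub>L\<^esub> y \<and> B \<in> \<I> \<and>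
      (\<forall>r\<in>carrier R. \<forall>r'\<in>carrier R. f r' \<ominus>\<^bsub>L\<^esub> f r \<in> A \<longleftrightarrow> r' \<ominus> r \<in> B)"
    and fip: "\<And>\<F>. finite \<F> \<Longrightarrow> \<F> \<subseteq> \<C> \<Longrightarrow> \<exists>r\<in>carrier R. \<forall>C\<in>\<F>. f r \<in> C"
  shows "\<exists>r\<in>carrier R. \<forall>C\<in>\<C>. f r \<in> C"
proof -
  define pre where "pre C = {r \<in> carrier R. f r \<in> C}" for C
  have "\<exists>r\<in>carrier R. \<forall>C\<in>pre ` \<C>. r \<in> C"
  proof (rule linearly_compact_wrtD[OF lc])
    fix D assume "D \<in> pre ` \<C>"
    then obtain C where C: "C \<in> \<C>" "D = pre C" by blast
    obtain y A B where y: "y \<in> carrier L" and A: "ideal A L" "C = A +>\<^bsub>L\<^esub> y" and B: "B \<in> \<I>"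
      and AB: "\<And>r r'. r \<in> carrier R \<Longrightarrow> r' \<in> carrier R \<Longrightarrow>
        f r' \<ominus>\<^bsub>L\<^esub> f r \<in> A \<longleftrightarrow> r' \<ominus> r \<in> B"
      using cosets[OF C(1)] by auto
    interpret A: ideal A L by fact
    interpret B: ideal B R using ideals B .
    obtain r where r: "r \<in> carrier R" "f r \<in> C"
      using fip[of "{C}"] C(1) by auto
    have fr: "f r \<ominus>\<^bsub>L\<^esub> y \<in> A"
      using r A.mem_coset_iff[OF y] A(2) by simp
    have "r' \<in> D \<longleftrightarrow> r' \<in> B +> r" if r': "r' \<in> carrier R" for r'
    proof -
      have "r' \<in> D \<longleftrightarrow> f r' \<ominus>\<^bsub>L\<^esub> y \<in> A"
        using r' C(2) A(2) A.mem_coset_iff[OF y] f by (simp add: pre_def)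
      also have "\<dots> \<longleftrightarrow> f r' \<ominus>\<^bsub>L\<^esub> f r \<in> A"
        using A.diff_trans A.diff_sym fr f r r' y by meson
      also have "\<dots> \<longleftrightarrow> r' \<in> B +> r"
        using AB r r' B.mem_coset_iff by simp
      finally show ?thesis .
    qed
    then have "D = B +> r"
      using C(2) B.mem_coset_iff[OF r(1)] by (auto simp: pre_def)
    then show "\<exists>x A. x \<in> carrier R \<and> A \<in> \<I> \<and> D = A +> x"
      using r(1) B by blast
  next
    fix \<F> assume "finite \<F>" "\<F> \<subseteq> pre ` \<C>"
    then obtain \<F>' where "\<F>' \<subseteq> \<C>" "finite \<F>'" "\<F> = pre ` \<F>'"
      using finite_subset_image by metis
    then show "\<exists>r\<in>carrier R. \<forall>C\<in>\<F>. r \<in> C"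
      using fip[of \<F>'] by (auto simp: pre_def)
  qed
  then show ?thesis by (auto simp: pre_def)
qed

section \<open>Homomorphisms whose image contains all proper ideals\<close>

text \<open>
  This is the common feature of \<open>R \<rightarrow> R/P\<close> and \<open>R \<rightarrow> R\<^sub>P\<close>. The whole ring \<open>L\<close> need not lie in the image,
  but its only coset is \<open>L\<close>, which imposes no condition on a common point.
\<close>

locale ideal_covering_hom = ring_hom_cring R L f
  for R (structure) and L (structure) and f +
  assumes proper_ideal_subset_image: "\<lbrakk>ideal A L; A \<noteq> carrier L\<rbrakk> \<Longrightarrow> A \<subseteq> f ` carrier R"
begin

definition contraction where
  "contraction A = {r \<in> carrier R. f r \<in> A}"

lemma ideal_contraction:
  assumes "ideal A L"
  shows "ideal (contraction A) R"
  unfolding contraction_def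
  by (rule ring_hom_ring.ideal_vimage[OF ring_hom_ringI2[OF R.ring_axioms S.ring_axioms homh] assms])

lemma diff_mem_contraction_iff:
  assumes "r \<in> carrier R" "r' \<in> carrier R"
  shows "r' \<ominus> r \<in> contraction A \<longleftrightarrow> f r' \<ominus>\<^bsub>L\<^esub> f r \<in> A"
  using assms by (simp add: contraction_def a_minus_def)

text \<open>
  A proper ideal of \<open>L\<close> is the image of its contraction, so comparability of contractions carries over.
\<close>

lemma valuation_ring_codomain:
  assumes "valuation_ring R" "\<one>\<^bsub>L\<^esub> \<noteq> \<zero>\<^bsub>L\<^esub>"
  shows "valuation_ring L"
proof (unfold_locales; (fact)?)
  fix I J assume I: "ideal I L" and J: "ideal J L"
  interpret R: valuation_ring R by fact
  have *: "A \<subseteq> B" if "ideal A L" "ideal B L" "contraction A \<subseteq> contraction B" "A \<noteq> carrier L" for A B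
    using proper_ideal_subset_image[OF that(1,4)] that(3) by (auto simp: contraction_def)
  have "contraction I \<subseteq> contraction J \<or> contraction J \<subseteq> contraction I"
    by (intro R.ideals_linear ideal_contraction I J)
  moreover have "I \<subseteq> carrier L" "J \<subseteq> carrier L"
    using ideal.Icarr[OF I] ideal.Icarr[OF J] by auto
  ultimately show "I \<subseteq> J \<or> J \<subseteq> I"
    using *[OF I J] *[OF J I] by (cases "I = carrier L"; cases "J = carrier L") auto
qed

text \<open>
  Centres of cosets need not lie in the image of \<open>f\<close>, so \<open>f\<close> itself cannot be used to pull the cosets
  back. Translating by the centre of one coset with a proper ideal \<open>A\<^sub>0\<close> repairs this: only the
  points of that coset matter, and their differences from its centre lie in \<open>A\<^sub>0\<close>, hence in the
  image of \<open>f\<close>.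
\<close>

lemma linearly_compact_codomain:
  assumes "linearly_compact R"
  shows "linearly_compact L"
  unfolding linearly_compact_iff
proof (rule linearly_compact_wrtI)
  fix \<C> x A
  assume cosets: "\<And>C. C \<in> \<C> \<Longrightarrow> x C \<in> carrier L \<and> A C \<in> {A. ideal A L} \<and> C = A C +>\<^bsub>L\<^esub> x C"
    and fip: "\<And>\<F>. finite \<F> \<Longrightarrow> \<F> \<subseteq> \<C> \<Longrightarrow> \<exists>y\<in>carrier L. \<forall>C\<in>\<F>. y \<in> C"
  have mem: "y \<in> C \<longleftrightarrow> y \<in> carrier L \<and> y \<ominus>\<^bsub>L\<^esub> x C \<in> A C" if "C \<in> \<C>" for y C
    using cosets[OF that] ideal.mem_coset_iff[of "A C" L "x C" y] by simp
  show "\<exists>y\<in>carrier L. \<forall>C\<in>\<C>. y \<in> C"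
  proof (cases "\<forall>C\<in>\<C>. A C = carrier L")
    case True
    then have "\<zero>\<^bsub>L\<^esub> \<in> C" if "C \<in> \<C>" for C
      using mem[OF that] cosets[OF that] that by simp
    then show ?thesis using S.zero_closed by blast
  next
    case False
    then obtain C0 where C0: "C0 \<in> \<C>" "A C0 \<noteq> carrier L" by blast
    note x0 = cosets[OF C0(1)]
    define g where "g r = x C0 \<oplus>\<^bsub>L\<^esub> f r" for r
    have "\<exists>r\<in>carrier R. \<forall>C\<in>\<C>. g r \<in> C"
    proof (rule linearly_compact_wrt_pullback)
      show "linearly_compact_wrt R {A. ideal A R}"
        using assms by (simp add: linearly_compact_iff)
      show "g r \<in> carrier L" if "r \<in> carrier R" for r
        using that x0 by (simp add: g_def)
      show "\<exists>y A B. y \<in> carrier L \<and> ideal A L \<and> C = A +>\<^bsub>L\<^esub> y \<and> B \<in> {A. ideal A R} \<and>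
        (\<forall>r\<in>carrier R. \<forall>r'\<in>carrier R. g r' \<ominus>\<^bsub>L\<^esub> g r \<in> A \<longleftrightarrow> r' \<ominus> r \<in> B)" if "C \<in> \<C>" for C
      proof -
        have "g r' \<ominus>\<^bsub>L\<^esub> g r = f r' \<ominus>\<^bsub>L\<^esub> f r" if "r \<in> carrier R" "r' \<in> carrier R" for r r'
        proof -
          have "f r \<in> carrier L" "f r' \<in> carrier L" "x C0 \<in> carrier L" using that x0 by auto
          then show ?thesis unfolding g_def by algebra
        qed
        then show ?thesis
          using cosets[OF that] ideal_contraction[of "A C"] diff_mem_contraction_iff[of _ _ "A C"]
          by (intro exI[of _ "x C"] exI[of _ "A C"] exI[of _ "contraction (A C)"]) simp
      qed
      show "\<exists>r\<in>carrier R. \<forall>C\<in>\<F>. g r \<in> C" if fin: "finite \<F>" "\<F> \<subseteq> \<C>" for \<F>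
      proof -
        obtain y where y: "y \<in> carrier L" "\<forall>C\<in>insert C0 \<F>. y \<in> C"
          using fip[of "insert C0 \<F>"] fin C0(1) by auto
        then have "y \<ominus>\<^bsub>L\<^esub> x C0 \<in> A C0" using mem[OF C0(1)] by simp
        then obtain r where r: "r \<in> carrier R" "y \<ominus>\<^bsub>L\<^esub> x C0 = f r"
          using proper_ideal_subset_image[of "A C0"] C0(2) x0 by auto
        have "x C0 \<oplus>\<^bsub>L\<^esub> (y \<ominus>\<^bsub>L\<^esub> x C0) = y" using y(1) x0 by algebra
        then have "g r = y" using r(2) by (simp add: g_def)
        then show ?thesis using r(1) y(2) by auto
      qed
    qed (auto intro: R.ring_axioms S.ring_axioms)
    then show ?thesis using x0 by (auto simp: g_def)
  qed
qed

text \<open>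
  The cosets in \<open>R\<close> are the preimages of the cosets with the same centres in \<open>L\<close>. Those have a common
  point, and one of them having a proper ideal forces this point into the image of \<open>f\<close>.
\<close>

lemma linearly_compact_wrt_contractions:
  assumes "linearly_compact L"
  shows "linearly_compact_wrt R (contraction ` {A. ideal A L})"
proof (rule linearly_compact_wrtI)
  fix \<C> x B
  assume cosets: "\<And>C. C \<in> \<C> \<Longrightarrow>
      x C \<in> carrier R \<and> B C \<in> contraction ` {A. ideal A L} \<and> C = B C +> x C"
    and fip: "\<And>\<F>. finite \<F> \<Longrightarrow> \<F> \<subseteq> \<C> \<Longrightarrow> \<exists>r\<in>carrier R. \<forall>C\<in>\<F>. r \<in> C"
  have "\<forall>C\<in>\<C>. \<exists>A. ideal A L \<and> B C = contraction A" using cosets by blast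
  then obtain A where A: "\<And>C. C \<in> \<C> \<Longrightarrow> ideal (A C) L \<and> B C = contraction (A C)"
    using bchoice by metis
  have mem: "r \<in> C \<longleftrightarrow> r \<in> carrier R \<and> f r \<ominus>\<^bsub>L\<^esub> f (x C) \<in> A C" if "C \<in> \<C>" for r C
    using cosets[OF that] A[OF that] ideal.mem_coset_iff[OF ideal_contraction, of "A C" "x C" r]
      diff_mem_contraction_iff by auto
  show "\<exists>r\<in>carrier R. \<forall>C\<in>\<C>. r \<in> C"
  proof (cases "\<forall>C\<in>\<C>. A C = carrier L")
    case True
    then have "\<zero> \<in> C" if "C \<in> \<C>" for C
      using mem[OF that] cosets[OF that] that by simp
    then show ?thesis using R.zero_closed by blast
  next
    case False
    then obtain C0 where C0: "C0 \<in> \<C>" "A C0 \<noteq> carrier L" by blast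
    define D where "D C = A C +>\<^bsub>L\<^esub> f (x C)" for C
    have memD: "y \<in> D C \<longleftrightarrow> y \<in> carrier L \<and> y \<ominus>\<^bsub>L\<^esub> f (x C) \<in> A C" if "C \<in> \<C>" for y C
      using ideal.mem_coset_iff[of "A C" L "f (x C)"] A[OF that] cosets[OF that]
      by (simp add: D_def)
    have "\<exists>y\<in>carrier L. \<forall>C\<in>D ` \<C>. y \<in> C"
    proof (rule linearly_compact_wrtD)
      show "linearly_compact_wrt L {A. ideal A L}"
        using assms by (simp add: linearly_compact_iff)
      show "\<exists>y A. y \<in> carrier L \<and> A \<in> {A. ideal A L} \<and> E = A +>\<^bsub>L\<^esub> y" if "E \<in> D ` \<C>" for E
      proof -
        obtain C where "C \<in> \<C>" "E = D C" using \<open>E \<in> D ` \<C>\<close> by blast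
        then show ?thesis
          using A[of C] cosets[of C] by (intro exI[of _ "f (x C)"] exI[of _ "A C"]) (simp add: D_def)
      qed
      show "\<exists>y\<in>carrier L. \<forall>C\<in>\<F>. y \<in> C" if fin: "finite \<F>" "\<F> \<subseteq> D ` \<C>" for \<F>
      proof -
        obtain \<G> where \<G>: "finite \<G>" "\<G> \<subseteq> \<C>" "\<F> = D ` \<G>"
          using finite_subset_image[OF fin] by metis
        then obtain r where r: "r \<in> carrier R" "\<forall>C\<in>\<G>. r \<in> C" using fip by blast
        have "f r \<in> D C" if "C \<in> \<G>" for C
          using that r \<G>(2) mem[of C r] memD[of C "f r"] by auto
        then show ?thesis using r(1) \<G>(3) by auto
      qed
    qed
    then obtain y where y: "y \<in> carrier L" "\<And>C. C \<in> \<C> \<Longrightarrow> y \<ominus>\<^bsub>L\<^esub> f (x C) \<in> A C"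
      using memD by auto
    then obtain r where r: "r \<in> carrier R" "y \<ominus>\<^bsub>L\<^esub> f (x C0) = f r"
      using proper_ideal_subset_image[of "A C0"] C0 A by blast
    have x0: "x C0 \<in> carrier R" "f (x C0) \<in> carrier L" using cosets[OF C0(1)] by auto
    have "y = (y \<ominus>\<^bsub>L\<^esub> f (x C0)) \<oplus>\<^bsub>L\<^esub> f (x C0)" using y(1) x0 by algebra
    then have "f (r \<oplus> x C0) = y" using r x0 by simp
    then have "r \<oplus> x C0 \<in> C" if "C \<in> \<C>" for C
      using mem[OF that] y(2)[OF that] r(1) x0 by simp
    then show ?thesis using r(1) x0 by blast
  qed
qed

end

section \<open>Localization and saturation\<close>

definition saturation :: "('a, 'm) ring_scheme \<Rightarrow> 'a set \<Rightarrow> 'a set \<Rightarrow> 'a set" where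
  "saturation R S A = {r \<in> carrier R. \<exists>s\<in>S. s \<otimes>\<^bsub>R\<^esub> r \<in> A}"

locale localized_cring = cring R for R (structure) +
  fixes S
  assumes denominators_subset: "S \<subseteq> carrier R"
    and one_denominator: "\<one> \<in> S"
    and mult_denominator: "\<lbrakk>s \<in> S; t \<in> S\<rbrakk> \<Longrightarrow> s \<otimes> t \<in> S"
begin

abbreviation frac where "frac a s \<equiv> fraction R S a s"
abbreviation RS where "RS \<equiv> localization R S"

lemma denominator_closed: "s \<in> S \<Longrightarrow> s \<in> carrier R"
  using denominators_subset by blast

text \<open>
  This is the relation whose classes are the fractions, written without differences, so that
  transitivity and compatibility reduce to rearranging products.
\<close>

definition fraction_rel where
  "fraction_rel = {((a, s), (b, t)). a \<in> carrier R \<and> s \<in> S \<and> b \<in> carrier R \<and> t \<in> S \<and>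
    (\<exists>u\<in>S. u \<otimes> (a \<otimes> t) = u \<otimes> (b \<otimes> s))}"

lemma annihilated_diff_iff:
  assumes "u \<in> carrier R" "x \<in> carrier R" "y \<in> carrier R"
  shows "u \<otimes> (x \<ominus> y) = \<zero> \<longleftrightarrow> u \<otimes> x = u \<otimes> y"
proof -
  have "u \<otimes> (x \<ominus> y) = u \<otimes> x \<ominus> u \<otimes> y" using assms by algebra
  then show ?thesis using assms by (metis m_closed r_right_minus_eq)
qed

lemma equiv_fraction_rel: "equiv (carrier R \<times> S) fraction_rel"
proof (rule equivI)
  show "refl_on (carrier R \<times> S) fraction_rel"
    using one_denominator by (auto simp: refl_on_def fraction_rel_def)
  show "sym fraction_rel" by (auto simp: sym_def fraction_rel_def dest: sym)
  show "trans fraction_rel"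
  proof (rule transI, clarsimp simp: fraction_rel_def)
    fix a s b t c r u v
    assume S: "s \<in> S" "t \<in> S" "r \<in> S" "u \<in> S" "v \<in> S"
      and R: "a \<in> carrier R" "b \<in> carrier R" "c \<in> carrier R"
      and u: "u \<otimes> (a \<otimes> t) = u \<otimes> (b \<otimes> s)" and v: "v \<otimes> (b \<otimes> r) = v \<otimes> (c \<otimes> t)"
    note carr = S[THEN denominator_closed] R
    have "(u \<otimes> v \<otimes> t) \<otimes> (a \<otimes> r) = (v \<otimes> r) \<otimes> (u \<otimes> (a \<otimes> t))" using carr by (simp add: m_ac)
    also have "\<dots> = (u \<otimes> s) \<otimes> (v \<otimes> (b \<otimes> r))" unfolding u using carr by (simp add: m_ac)
    also have "\<dots> = (u \<otimes> v \<otimes> t) \<otimes> (c \<otimes> s)" unfolding v using carr by (simp add: m_ac)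
    finally show "\<exists>u\<in>S. u \<otimes> (a \<otimes> r) = u \<otimes> (c \<otimes> s)"
      using S mult_denominator by blast
  qed
qed (auto simp: fraction_rel_def)

lemma fraction_eq_class:
  assumes "a \<in> carrier R" "s \<in> S"
  shows "frac a s = fraction_rel `` {(a, s)}"
  using assms
  by (auto simp: fraction_def fraction_rel_def annihilated_diff_iff denominator_closed)

lemma fraction_eqI:
  assumes "a \<in> carrier R" "s \<in> S" "b \<in> carrier R" "t \<in> S" "u \<in> S"
    "u \<otimes> (a \<otimes> t) = u \<otimes> (b \<otimes> s)"
  shows "frac a s = frac b t"
proof -
  have "((a, s), (b, t)) \<in> fraction_rel" using assms by (auto simp: fraction_rel_def)
  then show ?thesis
    using equiv_class_eq[OF equiv_fraction_rel] assms by (simp add: fraction_eq_class)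
qed

lemma fraction_eq_iff:
  assumes "a \<in> carrier R" "s \<in> S" "b \<in> carrier R" "t \<in> S"
  shows "frac a s = frac b t \<longleftrightarrow> (\<exists>u\<in>S. u \<otimes> (a \<otimes> t) = u \<otimes> (b \<otimes> s))"
proof
  assume "frac a s = frac b t"
  then have "((a, s), (b, t)) \<in> fraction_rel"
    using eq_equiv_class_iff[OF equiv_fraction_rel] assms by (simp add: fraction_eq_class)
  then show "\<exists>u\<in>S. u \<otimes> (a \<otimes> t) = u \<otimes> (b \<otimes> s)" by (auto simp: fraction_rel_def)
qed (use fraction_eqI assms in blast)

lemma fraction_cong_eq:
  assumes "a \<in> carrier R" "s \<in> S" "b \<in> carrier R" "t \<in> S" "a \<otimes> t = b \<otimes> s"
  shows "frac a s = frac b t"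
  using fraction_eqI[OF assms(1-4) one_denominator] assms(5) by simp

lemma mult_fraction:
  assumes "a \<in> carrier R" "s \<in> S" "b \<in> carrier R" "t \<in> S"
  shows "frac a s \<otimes>\<^bsub>RS\<^esub> frac b t = frac (a \<otimes> b) (s \<otimes> t)"
proof -
  have "(\<lambda>p q. frac (fst p \<otimes> fst q) (snd p \<otimes> snd q)) respects2 fraction_rel"
  proof (rule congruent2_commuteI[OF equiv_fraction_rel]; clarsimp)
    fix a s b t assume "a \<in> carrier R" "s \<in> S" "b \<in> carrier R" "t \<in> S"
    then show "frac (a \<otimes> b) (s \<otimes> t) = frac (b \<otimes> a) (t \<otimes> s)"
      by (simp add: m_comm denominator_closed)
  next
    fix a s b t c r assume *: "((a, s), (b, t)) \<in> fraction_rel" "c \<in> carrier R" "r \<in> S"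
    then obtain u where S: "s \<in> S" "t \<in> S" "r \<in> S" "u \<in> S"
      and R: "a \<in> carrier R" "b \<in> carrier R" "c \<in> carrier R"
      and u: "u \<otimes> (a \<otimes> t) = u \<otimes> (b \<otimes> s)"
      by (auto simp: fraction_rel_def)
    note carr = S[THEN denominator_closed] R
    have "u \<otimes> ((c \<otimes> a) \<otimes> (r \<otimes> t)) = (c \<otimes> r) \<otimes> (u \<otimes> (a \<otimes> t))" using carr by (simp add: m_ac)
    also have "\<dots> = u \<otimes> ((c \<otimes> b) \<otimes> (r \<otimes> s))" unfolding u using carr by (simp add: m_ac)
    finally show "frac (c \<otimes> a) (r \<otimes> s) = frac (c \<otimes> b) (r \<otimes> t)"
      using S R mult_denominator by (intro fraction_eqI[of _ _ _ _ u]) auto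
  qed
  from UN_equiv_class2[OF equiv_fraction_rel equiv_fraction_rel this, of "(a, s)" "(b, t)"] assms
  show ?thesis
    by (simp add: localization_def fraction_eq_class[OF assms(1,2)] fraction_eq_class[OF assms(3,4)]
      case_prod_unfold)
qed

lemma add_fraction:
  assumes "a \<in> carrier R" "s \<in> S" "b \<in> carrier R" "t \<in> S"
  shows "frac a s \<oplus>\<^bsub>RS\<^esub> frac b t = frac (a \<otimes> t \<oplus> b \<otimes> s) (s \<otimes> t)"
proof -
  have "(\<lambda>p q. frac (fst p \<otimes> snd q \<oplus> fst q \<otimes> snd p) (snd p \<otimes> snd q)) respects2 fraction_rel"
  proof (rule congruent2_commuteI[OF equiv_fraction_rel]; clarsimp)
    fix a s b t assume "a \<in> carrier R" "s \<in> S" "b \<in> carrier R" "t \<in> S"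
    then show "frac (a \<otimes> t \<oplus> b \<otimes> s) (s \<otimes> t) = frac (b \<otimes> s \<oplus> a \<otimes> t) (t \<otimes> s)"
      by (simp add: m_comm a_comm denominator_closed)
  next
    fix a s b t c r assume *: "((a, s), (b, t)) \<in> fraction_rel" "c \<in> carrier R" "r \<in> S"
    then obtain u where S: "s \<in> S" "t \<in> S" "r \<in> S" "u \<in> S"
      and R: "a \<in> carrier R" "b \<in> carrier R" "c \<in> carrier R"
      and u: "u \<otimes> (a \<otimes> t) = u \<otimes> (b \<otimes> s)"
      by (auto simp: fraction_rel_def)
    note carr = S[THEN denominator_closed] R
    have "u \<otimes> ((c \<otimes> s \<oplus> a \<otimes> r) \<otimes> (r \<otimes> t)) = u \<otimes> c \<otimes> s \<otimes> r \<otimes> t \<oplus> (r \<otimes> r) \<otimes> (u \<otimes> (a \<otimes> t))"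
      using carr by algebra
    also have "\<dots> = u \<otimes> ((c \<otimes> t \<oplus> b \<otimes> r) \<otimes> (r \<otimes> s))" unfolding u using carr by algebra
    finally show "frac (c \<otimes> s \<oplus> a \<otimes> r) (r \<otimes> s) = frac (c \<otimes> t \<oplus> b \<otimes> r) (r \<otimes> t)"
      using S R mult_denominator denominator_closed by (intro fraction_eqI[of _ _ _ _ u]) auto
  qed
  from UN_equiv_class2[OF equiv_fraction_rel equiv_fraction_rel this, of "(a, s)" "(b, t)"] assms
  show ?thesis
    by (simp add: localization_def fraction_eq_class[OF assms(1,2)] fraction_eq_class[OF assms(3,4)]
      case_prod_unfold)
qed

lemma carrier_localization: "carrier RS = {frac a s | a s. a \<in> carrier R \<and> s \<in> S}"
  and one_localization: "\<one>\<^bsub>RS\<^esub> = frac \<one> \<one>"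
  and zero_localization: "\<zero>\<^bsub>RS\<^esub> = frac \<zero> \<one>"
  by (simp_all add: localization_def)

lemma fraction_closed: "\<lbrakk>a \<in> carrier R; s \<in> S\<rbrakk> \<Longrightarrow> frac a s \<in> carrier RS"
  by (auto simp: carrier_localization)

lemma localizationE:
  assumes "x \<in> carrier RS"
  obtains a s where "x = frac a s" "a \<in> carrier R" "s \<in> S" "s \<in> carrier R"
  using assms denominator_closed by (auto simp: carrier_localization)

lemmas localization_simps =
  mult_fraction add_fraction one_localization zero_localization fraction_closed
  one_denominator mult_denominator

lemma cring_localization: "cring RS"
proof (rule cringI)
  show "abelian_group RS"
  proof (rule abelian_groupI)
    fix x y z assume "x \<in> carrier RS" "y \<in> carrier RS" "z \<in> carrier RS"
    then show "(x \<oplus>\<^bsub>RS\<^esub> y) \<oplus>\<^bsub>RS\<^esub> z = x \<oplus>\<^bsub>RS\<^esub> (y \<oplus>\<^bsub>RS\<^esub> z)"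
      by (auto elim!: localizationE simp: localization_simps l_distr r_distr m_ac a_ac)
  next
    fix x assume "x \<in> carrier RS"
    then obtain a s where as: "x = frac a s" "a \<in> carrier R" "s \<in> S" "s \<in> carrier R"
      by (rule localizationE)
    then have "frac (\<ominus> a) s \<oplus>\<^bsub>RS\<^esub> x = frac (\<ominus> a \<otimes> s \<oplus> a \<otimes> s) (s \<otimes> s)"
      by (simp add: add_fraction)
    also have "\<dots> = \<zero>\<^bsub>RS\<^esub>"
      unfolding zero_localization using as
      by (intro fraction_cong_eq) (simp_all add: localization_simps l_minus l_neg)
    finally have "frac (\<ominus> a) s \<oplus>\<^bsub>RS\<^esub> x = \<zero>\<^bsub>RS\<^esub>" .
    then show "\<exists>y\<in>carrier RS. y \<oplus>\<^bsub>RS\<^esub> x = \<zero>\<^bsub>RS\<^esub>" using as fraction_closed by blast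
  qed (auto elim!: localizationE simp: localization_simps a_comm m_comm)
  show "comm_monoid RS"
    by (rule comm_monoidI) (auto elim!: localizationE simp: localization_simps m_ac)
  fix x y z assume "x \<in> carrier RS" "y \<in> carrier RS" "z \<in> carrier RS"
  then obtain a s b t c r where x: "x = frac a s" "a \<in> carrier R" "s \<in> S"
    and y: "y = frac b t" "b \<in> carrier R" "t \<in> S" and z: "z = frac c r" "c \<in> carrier R" "r \<in> S"
    by (metis localizationE)
  note carr = x(2) y(2) z(2) denominator_closed[OF x(3)] denominator_closed[OF y(3)]
    denominator_closed[OF z(3)]
  have "(x \<oplus>\<^bsub>RS\<^esub> y) \<otimes>\<^bsub>RS\<^esub> z = frac ((a \<otimes> t \<oplus> b \<otimes> s) \<otimes> c) (s \<otimes> t \<otimes> r)"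
    using x y z carr by (simp add: localization_simps)
  also have "\<dots> = frac (a \<otimes> c \<otimes> (t \<otimes> r) \<oplus> b \<otimes> c \<otimes> (s \<otimes> r)) (s \<otimes> r \<otimes> (t \<otimes> r))"
  proof (rule fraction_cong_eq)
    show "(a \<otimes> t \<oplus> b \<otimes> s) \<otimes> c \<otimes> (s \<otimes> r \<otimes> (t \<otimes> r)) =
        (a \<otimes> c \<otimes> (t \<otimes> r) \<oplus> b \<otimes> c \<otimes> (s \<otimes> r)) \<otimes> (s \<otimes> t \<otimes> r)"
      using carr by algebra
  qed (use x y z carr in \<open>simp_all add: mult_denominator\<close>)
  also have "\<dots> = x \<otimes>\<^bsub>RS\<^esub> z \<oplus>\<^bsub>RS\<^esub> y \<otimes>\<^bsub>RS\<^esub> z"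
    using x y z carr by (simp add: localization_simps)
  finally show "(x \<oplus>\<^bsub>RS\<^esub> y) \<otimes>\<^bsub>RS\<^esub> z = x \<otimes>\<^bsub>RS\<^esub> z \<oplus>\<^bsub>RS\<^esub> y \<otimes>\<^bsub>RS\<^esub> z" .
qed

lemma localization_hom: "ring_hom_cring R RS (\<lambda>a. frac a \<one>)"
proof (rule ring_hom_cringI[OF is_cring cring_localization])
  show "(\<lambda>a. frac a \<one>) \<in> ring_hom R RS"
    by (rule ring_hom_memI) (simp_all add: localization_simps)
qed

text \<open>
  These fractions already form the ideal generated by the image of \<open>A\<close>, since two fractions have a common
  denominator.
\<close>

definition extension where
  "extension A = {frac a s | a s. a \<in> A \<and> s \<in> S}"

lemma ideal_extension:
  assumes "ideal A R"
  shows "ideal (extension A) RS"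
proof -
  interpret A: ideal A R by fact
  interpret RS: cring RS by (rule cring_localization)
  have l: "x \<otimes>\<^bsub>RS\<^esub> y \<in> extension A" if "x \<in> carrier RS" "y \<in> extension A" for x y
    using that A.I_l_closed A.Icarr
    by (force simp: extension_def mult_denominator mult_fraction elim!: localizationE)
  have carr: "extension A \<subseteq> carrier RS"
    using A.Icarr fraction_closed by (auto simp: extension_def)
  show ?thesis
  proof (rule idealI[OF RS.ring_axioms])
    show "subgroup (extension A) (add_monoid RS)"
    proof (rule RS.add.subgroupI[OF carr])
      show "extension A \<noteq> {}" using A.zero_closed one_denominator unfolding extension_def by blast
      show "\<ominus>\<^bsub>RS\<^esub> x \<in> extension A" if "x \<in> extension A" for x
        using l[OF _ that, of "\<ominus>\<^bsub>RS\<^esub> \<one>\<^bsub>RS\<^esub>"] that carr by (auto simp: RS.l_minus)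
      show "x \<oplus>\<^bsub>RS\<^esub> y \<in> extension A" if xy: "x \<in> extension A" "y \<in> extension A" for x y
      proof -
        obtain a s b t where ab: "x = frac a s" "y = frac b t" "a \<in> A" "b \<in> A" "s \<in> S" "t \<in> S"
          using xy by (auto simp: extension_def)
        then have "a \<otimes> t \<oplus> b \<otimes> s \<in> A"
          using A.I_r_closed denominator_closed by simp
        then show ?thesis
          using ab A.Icarr mult_denominator by (auto simp: extension_def add_fraction)
      qed
    qed
    show "x \<otimes>\<^bsub>RS\<^esub> y \<in> extension A" if "y \<in> extension A" "x \<in> carrier RS" for x y
      using l that by blast
    show "y \<otimes>\<^bsub>RS\<^esub> x \<in> extension A" if "y \<in> extension A" "x \<in> carrier RS" for x y
      using l[OF that(2,1)] RS.m_comm that carr by auto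
  qed
qed

text \<open>
  Extending \<open>A\<close> to the localization and contracting it again gives the saturation. This is how
  linear compactness of the localization speaks about ideals of \<open>R\<close>.
\<close>

lemma fraction_mem_extension_iff:
  assumes "ideal A R" "r \<in> carrier R"
  shows "frac r \<one> \<in> extension A \<longleftrightarrow> r \<in> saturation R S A"
proof
  interpret A: ideal A R by fact
  assume "frac r \<one> \<in> extension A"
  then obtain a s where a: "a \<in> A" "s \<in> S" "frac r \<one> = frac a s" by (auto simp: extension_def)
  then obtain u where u: "u \<in> S" "u \<otimes> (r \<otimes> s) = u \<otimes> (a \<otimes> \<one>)"
    using fraction_eq_iff[of r \<one> a s] assms(2) A.Icarr one_denominator by auto
  have carr: "u \<in> carrier R" "s \<in> carrier R" "a \<in> carrier R"
    using u a denominator_closed A.Icarr by auto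
  then have "(u \<otimes> s) \<otimes> r = u \<otimes> a" using u(2) assms(2) by (simp add: m_ac)
  then have "(u \<otimes> s) \<otimes> r \<in> A" using A.I_l_closed a carr by simp
  then show "r \<in> saturation R S A"
    using u(1) a(2) mult_denominator assms(2) unfolding saturation_def by blast
next
  assume "r \<in> saturation R S A"
  then obtain s where s: "s \<in> S" "s \<otimes> r \<in> A" by (auto simp: saturation_def)
  then have "frac r \<one> = frac (s \<otimes> r) s"
    using assms(2) one_denominator denominator_closed
    by (intro fraction_cong_eq) (auto simp: m_comm)
  then show "frac r \<one> \<in> extension A" using s by (auto simp: extension_def)
qed

lemma ideal_saturation:
  assumes "ideal A R"
  shows "ideal (saturation R S A) R"
proof -
  interpret hom: ring_hom_cring R RS "\<lambda>a. frac a \<one>" by (rule localization_hom)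
  have "ideal {r \<in> carrier R. frac r \<one> \<in> extension A} R"
    by (rule ring_hom_ring.ideal_vimage[OF _ ideal_extension[OF assms]])
      (rule ring_hom_ringI2[OF ring_axioms cring.axioms(1)[OF cring_localization] hom.homh])
  also have "{r \<in> carrier R. frac r \<one> \<in> extension A} = {r \<in> carrier R. r \<in> saturation R S A}"
    using fraction_mem_extension_iff[OF assms] by (intro Collect_cong conj_cong refl)
  also have "\<dots> = saturation R S A" by (auto simp: saturation_def)
  finally show ?thesis .
qed

end

section \<open>Prime ideals of valuation rings\<close>

context valuation_ring
begin

lemma ideal_subset_PIdl:
  assumes "ideal A R" "x \<in> carrier R" "x \<notin> A"
  shows "A \<subseteq> PIdl x"
  using ideals_linear[OF assms(1) cgenideal_ideal[OF assms(2)]] cgenideal_self[OF assms(2)] assms(3)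
  by blast

text \<open>
  In other words \<open>s P = P\<close>: multiplication by a denominator of \<open>R\<^sub>P\<close> does not shrink \<open>P\<close>, since the
  ideal generated by \<open>s\<close> is not contained in \<open>P\<close> and must therefore contain it.
\<close>

lemma prime_divisible:
  assumes "primeideal P R" "s \<in> carrier R - P" "p \<in> P"
  obtains q where "q \<in> P" "p = s \<otimes> q"
proof -
  interpret P: primeideal P R by fact
  have "p \<in> PIdl s"
    using ideal_subset_PIdl[OF P.is_ideal] assms(2,3) by blast
  then obtain q where q: "q \<in> carrier R" "p = q \<otimes> s"
    by (auto simp: cgenideal_def)
  then have "q \<in> P" using P.I_prime[of q s] assms(2,3) by auto
  then show thesis using that q assms(2) m_comm by auto
qed

text \<open>
  Of two elements one divides the other. If \<open>a = c b\<close>, then \<open>a\<^sup>2 = c (a b)\<close>, so \<open>a\<close> is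
  nilpotent together with \<open>a b\<close>; and \<open>a + b = (c + 1) b\<close> is nilpotent together with \<open>b\<close>.
\<close>

lemma primeideal_nilradical: "primeideal (nilradical R) R"
proof -
  have l: "x \<otimes> a \<in> nilradical R" if "a \<in> nilradical R" "x \<in> carrier R" for a x
  proof -
    obtain n :: nat where "a \<in> carrier R" "a [^] n = \<zero>" using \<open>a \<in> nilradical R\<close> by (auto simp: nilradical_def)
    moreover from this have "(x \<otimes> a) [^] n = \<zero>" using that(2) by (simp add: nat_pow_distrib)
    ultimately show ?thesis using that(2) by (auto simp: nilradical_def)
  qed
  have sq: "a \<in> nilradical R" if a: "a \<in> carrier R" "a \<otimes> a \<in> nilradical R" for a
  proof -
    obtain n :: nat where "(a \<otimes> a) [^] n = \<zero>" using a(2) by (auto simp: nilradical_def)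
    then have "a [^] (n + n) = \<zero>" using that(1) by (simp add: nat_pow_distrib nat_pow_mult)
    then show ?thesis using that(1) by (auto simp: nilradical_def)
  qed
  have comparable: "(\<exists>c\<in>carrier R. a = c \<otimes> b) \<or> (\<exists>c\<in>carrier R. b = c \<otimes> a)"
    if "a \<in> carrier R" "b \<in> carrier R" for a b
  proof -
    have "PIdl a \<subseteq> PIdl b \<or> PIdl b \<subseteq> PIdl a"
      using that by (intro ideals_linear cgenideal_ideal)
    then have "a \<in> PIdl b \<or> b \<in> PIdl a" using that cgenideal_self by blast
    then show ?thesis unfolding cgenideal_def by blast
  qed
  have add_aux: "a \<oplus> b \<in> nilradical R" if "b \<in> nilradical R" "c \<in> carrier R" "a = c \<otimes> b" for a b c
  proof -
    have "b \<in> carrier R" using that(1) by (simp add: nilradical_def)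
    then have "a \<oplus> b = (c \<oplus> \<one>) \<otimes> b" using that(2,3) by (simp add: l_distr)
    then show ?thesis using l that(1,2) by simp
  qed
  have carr: "nilradical R \<subseteq> carrier R" by (auto simp: nilradical_def)
  have "ideal (nilradical R) R"
  proof (rule idealI[OF ring_axioms])
    show "subgroup (nilradical R) (add_monoid R)"
    proof (rule add.subgroupI[OF carr])
      have "\<zero> \<in> nilradical R" by (auto simp: nilradical_def intro!: exI[of _ 1])
      then show "nilradical R \<noteq> {}" by blast
      show "\<ominus> a \<in> nilradical R" if "a \<in> nilradical R" for a
        using l[OF that, of "\<ominus> \<one>"] that carr by (auto simp: l_minus)
      show "a \<oplus> b \<in> nilradical R" if "a \<in> nilradical R" "b \<in> nilradical R" for a b
        using comparable[of a b] add_aux[of b _ a] add_aux[of a _ b] a_comm that carr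
        by (metis subsetD)
    qed
    show "x \<otimes> a \<in> nilradical R" if "a \<in> nilradical R" "x \<in> carrier R" for a x
      using l that .
    show "a \<otimes> x \<in> nilradical R" if "a \<in> nilradical R" "x \<in> carrier R" for a x
      using l[OF that] that carr m_comm by auto
  qed
  moreover have "carrier R \<noteq> nilradical R"
  proof -
    have "\<one> \<notin> nilradical R" using one_not_zero by (simp add: nilradical_def)
    then show ?thesis using one_closed by blast
  qed
  moreover have "a \<in> nilradical R \<or> b \<in> nilradical R"
    if ab: "a \<in> carrier R" "b \<in> carrier R" "a \<otimes> b \<in> nilradical R" for a b
  proof -
    have "a \<otimes> a = c \<otimes> (a \<otimes> b)" if "c \<in> carrier R" "a = c \<otimes> b" for c
      using ab that(1) arg_cong[OF that(2), of "\<lambda>z. a \<otimes> z"] by (simp add: m_ac)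
    moreover have "b \<otimes> b = c \<otimes> (a \<otimes> b)" if "c \<in> carrier R" "b = c \<otimes> a" for c
      using ab that(1) arg_cong[OF that(2), of "\<lambda>z. z \<otimes> b"] by (simp add: m_ac)
    ultimately show ?thesis
      using comparable[OF ab(1,2)] sq l[OF ab(3)] ab(1,2) by metis
  qed
  ultimately show ?thesis by (intro primeidealI is_cring)
qed

lemma localized_cring_prime:
  assumes "primeideal P R"
  shows "localized_cring R (carrier R - P)"
proof -
  interpret P: primeideal P R by fact
  show ?thesis
    by unfold_locales (use P.I_prime P.one_imp_carrier P.I_notcarr in auto)
qed

text \<open>
  Suppose that \<open>A\<^sub>0\<close> contains none of the saturations of the ideals \<open>A\<^sub>i\<close>. Choose \<open>z\<close> in the
  saturation of \<open>A\<^sub>0\<close> but not in \<open>A\<^sub>0\<close>; then \<open>A\<^sub>0 \<subseteq> R z\<close> by comparability. Every \<open>A\<^sub>i\<close>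
  contains \<open>P z\<close>: its saturation has an element \<open>y\<close> outside \<open>A\<^sub>0\<close>, with \<open>s z \<in> A\<^sub>0 \<subseteq> R y\<close> and
  \<open>t y \<in> A\<^sub>i\<close> for denominators \<open>s\<close> and \<open>t\<close>, hence \<open>P z = P s z \<subseteq> P y = P t y \<subseteq> A\<^sub>i\<close>. Therefore
  the cosets pull back along \<open>r \<mapsto> x\<^sub>0 + r z\<close> to cosets of ideals containing \<open>P\<close>.
\<close>

lemma linearly_compact_if_above_and_saturated:
  assumes prime: "primeideal P R"
    and above: "linearly_compact_wrt R {A. ideal A R \<and> P \<subseteq> A}"
    and sat: "linearly_compact_wrt R (saturation R (carrier R - P) ` {A. ideal A R})"
  shows "linearly_compact R"
  unfolding linearly_compact_iff
proof (rule linearly_compact_wrtI)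
  let ?sat = "saturation R (carrier R - P)"
  interpret P: primeideal P R by fact
  interpret loc: localized_cring R "carrier R - P" by (rule localized_cring_prime[OF prime])
  fix \<C> x A
  assume cosets: "\<And>C. C \<in> \<C> \<Longrightarrow> x C \<in> carrier R \<and> A C \<in> {A. ideal A R} \<and> C = A C +> x C"
    and fip: "\<And>\<F>. finite \<F> \<Longrightarrow> \<F> \<subseteq> \<C> \<Longrightarrow> \<exists>r\<in>carrier R. \<forall>C\<in>\<F>. r \<in> C"
  have x: "x C \<in> carrier R" and A: "ideal (A C) R" if "C \<in> \<C>" for C using cosets[OF that] by auto
  have mem: "r \<in> C \<longleftrightarrow> r \<in> carrier R \<and> r \<ominus> x C \<in> A C" if "C \<in> \<C>" for r C
    using cosets[OF that] ideal.mem_coset_iff[of "A C" R "x C" r] by simp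
  have subset_sat: "A C \<subseteq> ?sat (A C)" if "C \<in> \<C>" for C
  proof
    fix a assume a: "a \<in> A C"
    have carr: "a \<in> carrier R" using ideal.Icarr[OF A[OF that] a] .
    then have "\<one> \<otimes> a \<in> A C" using a by simp
    then show "a \<in> ?sat (A C)" using carr loc.one_denominator unfolding saturation_def by blast
  qed
  show "\<exists>r\<in>carrier R. \<forall>C\<in>\<C>. r \<in> C"
  proof (cases "\<forall>C\<in>\<C>. \<exists>C'\<in>\<C>. ?sat (A C') \<subseteq> A C")
    case True
    \<comment> \<open>Enlarging each ideal to its saturation keeps the finite intersections nonempty, and a common
      point of the enlarged cosets already lies in the given ones.\<close>
    define D where "D C = ?sat (A C) +> x C" for C
    have memD: "r \<in> D C \<longleftrightarrow> r \<in> carrier R \<and> r \<ominus> x C \<in> ?sat (A C)" if "C \<in> \<C>" for r C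
      unfolding D_def by (rule ideal.mem_coset_iff[OF loc.ideal_saturation[OF A[OF that]] x[OF that]])
    have "\<exists>r\<in>carrier R. \<forall>C\<in>D ` \<C>. r \<in> C"
    proof (rule linearly_compact_wrtD[OF sat])
      show "\<exists>y B. y \<in> carrier R \<and> B \<in> ?sat ` {A. ideal A R} \<and> E = B +> y" if "E \<in> D ` \<C>" for E
        using that x A D_def by blast
      show "\<exists>r\<in>carrier R. \<forall>C\<in>\<F>. r \<in> C" if fin: "finite \<F>" "\<F> \<subseteq> D ` \<C>" for \<F>
      proof -
        obtain \<G> where \<G>: "finite \<G>" "\<G> \<subseteq> \<C>" "\<F> = D ` \<G>"
          using finite_subset_image[OF fin] by metis
        then obtain r where r: "r \<in> carrier R" "\<forall>C\<in>\<G>. r \<in> C" using fip by blast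
        have "r \<in> D C" if "C \<in> \<G>" for C
        proof -
          have "C \<in> \<C>" "r \<in> C" using that r(2) \<G>(2) by auto
          then show ?thesis using mem[of C r] memD[of C r] subset_sat[of C] by auto
        qed
        then show ?thesis using r(1) \<G>(3) by auto
      qed
    qed
    then obtain r where r: "r \<in> carrier R" "\<And>C. C \<in> \<C> \<Longrightarrow> r \<ominus> x C \<in> ?sat (A C)"
      using memD by auto
    have "r \<in> C" if C: "C \<in> \<C>" for C
    proof -
      interpret AC: ideal "A C" R using A C .
      obtain C' where C': "C' \<in> \<C>" "?sat (A C') \<subseteq> A C" using True C by blast
      \<comment> \<open>The centres of the two cosets are congruent modulo \<open>A C\<close>, because the cosets meet.\<close>
      obtain w where w: "w \<in> carrier R" "w \<in> C" "w \<in> C'" using fip[of "{C, C'}"] C C' by auto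
      have "w \<ominus> x C \<in> A C" using mem[OF C] w(2) by simp
      moreover have "w \<ominus> x C' \<in> A C" using mem[OF C'(1), of w] w(3) subset_sat[OF C'(1)] C'(2) by auto
      moreover have "r \<ominus> x C' \<in> A C" using r(2)[OF C'(1)] C'(2) by blast
      ultimately have "r \<ominus> x C \<in> A C"
        using AC.diff_trans AC.diff_sym r(1) w(1) x[OF C] x[OF C'(1)] by meson
      then show ?thesis using mem[OF C] r(1) by simp
    qed
    then show ?thesis using r(1) by blast
  next
    case False
    then obtain C0 where C0: "C0 \<in> \<C>" "\<And>C. C \<in> \<C> \<Longrightarrow> \<not> ?sat (A C) \<subseteq> A C0" by blast
    obtain z where z: "z \<in> ?sat (A C0)" "z \<notin> A C0" using C0 by blast
    then obtain s where s: "z \<in> carrier R" "s \<in> carrier R - P" "s \<otimes> z \<in> A C0"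
      by (auto simp: saturation_def)
    have Pz: "p \<otimes> z \<in> A C" if C: "C \<in> \<C>" and p: "p \<in> P" for C p
    proof -
      interpret AC: ideal "A C" R using A C .
      obtain y where y: "y \<in> ?sat (A C)" "y \<notin> A C0" using C0(2)[OF C] by blast
      then obtain t where t: "y \<in> carrier R" "t \<in> carrier R - P" "t \<otimes> y \<in> A C"
        by (auto simp: saturation_def)
      have "s \<otimes> z \<in> PIdl y"
        using ideal_subset_PIdl[OF A[OF C0(1)] t(1) y(2)] s(3) by blast
      then obtain c where c: "c \<in> carrier R" "s \<otimes> z = c \<otimes> y" by (auto simp: cgenideal_def)
      obtain q where q: "q \<in> P" "p = s \<otimes> q" using prime_divisible[OF prime s(2) p] .
      obtain q' where q': "q' \<in> P" "q = t \<otimes> q'" using prime_divisible[OF prime t(2) q(1)] .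
      have carr: "q' \<in> carrier R" "t \<in> carrier R" "s \<in> carrier R" using q' t s P.Icarr by auto
      have "p \<otimes> z = (t \<otimes> q') \<otimes> (s \<otimes> z)"
        using q(2) q'(2) carr s(1) by (simp add: m_ac)
      also have "\<dots> = (q' \<otimes> c) \<otimes> (t \<otimes> y)"
        unfolding c(2) using carr c(1) t(1) by (simp add: m_ac)
      finally show ?thesis using AC.I_l_closed t(3) carr c(1) by simp
    qed
    define g where "g r = x C0 \<oplus> r \<otimes> z" for r
    have "\<exists>r\<in>carrier R. \<forall>C\<in>\<C>. g r \<in> C"
    proof (rule linearly_compact_wrt_pullback[OF ring_axioms ring_axioms above])
      show "g r \<in> carrier R" if "r \<in> carrier R" for r
        using that x[OF C0(1)] s(1) by (simp add: g_def)
      show "\<exists>y A B. y \<in> carrier R \<and> ideal A R \<and> C = A +> y \<and> B \<in> {A. ideal A R \<and> P \<subseteq> A} \<and>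
        (\<forall>r\<in>carrier R. \<forall>r'\<in>carrier R. g r' \<ominus> g r \<in> A \<longleftrightarrow> r' \<ominus> r \<in> B)" if C: "C \<in> \<C>" for C
      proof -
        interpret AC: ideal "A C" R using A C .
        \<comment> \<open>The colon ideal of \<open>A C\<close> and \<open>z\<close>; it contains \<open>P\<close> by the choice of \<open>z\<close>.\<close>
        define B where "B = {r \<in> carrier R. r \<otimes> z \<in> A C}"
        have "ideal B R"
          unfolding B_def by (rule ideal_colon[OF A[OF C] s(1)])
        moreover have "P \<subseteq> B" using Pz[OF C] P.Icarr by (auto simp: B_def)
        moreover have "g r' \<ominus> g r \<in> A C \<longleftrightarrow> r' \<ominus> r \<in> B" if "r \<in> carrier R" "r' \<in> carrier R" for r r'
        proof -
          have "g r' \<ominus> g r = (r' \<ominus> r) \<otimes> z"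
            unfolding g_def using that s(1) x[OF C0(1)] by algebra
          then show ?thesis using that by (simp add: B_def)
        qed
        ultimately show ?thesis
          using cosets[OF C] by (intro exI[of _ "x C"] exI[of _ "A C"] exI[of _ B]) simp
      qed
      show "\<exists>r\<in>carrier R. \<forall>C\<in>\<F>. g r \<in> C" if fin: "finite \<F>" "\<F> \<subseteq> \<C>" for \<F>
      proof -
        obtain w where w: "w \<in> carrier R" "\<forall>C\<in>insert C0 \<F>. w \<in> C"
          using fip[of "insert C0 \<F>"] fin C0(1) by auto
        then have "w \<ominus> x C0 \<in> PIdl z"
          using ideal_subset_PIdl[OF A[OF C0(1)] s(1) z(2)] mem[OF C0(1)] by blast
        then obtain r where r: "r \<in> carrier R" "w \<ominus> x C0 = r \<otimes> z" by (auto simp: cgenideal_def)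
        have "x C0 \<oplus> (w \<ominus> x C0) = w" using w(1) x[OF C0(1)] by algebra
        then have "g r = w" using r(2) by (simp add: g_def)
        then show ?thesis using r(1) w(2) by auto
      qed
    qed auto
    then show ?thesis using x[OF C0(1)] s(1) by (auto simp: g_def)
  qed
qed

end

section \<open>Quotient and localization at a prime ideal\<close>

lemma (in primeideal) ideal_covering_hom_quotient:
  "ideal_covering_hom R (R Quot I) ((+>) I)"
proof -
  interpret hom: ring_hom_cring R "R Quot I" "(+>) I" by (rule rcos_ring_hom_cring)
  show ?thesis
  proof
    fix A assume "ideal A (R Quot I)"
    then have "A \<subseteq> carrier (R Quot I)" using ideal.Icarr[of A "R Quot I"] by blast
    then show "A \<subseteq> (+>) I ` carrier R"
      by (auto simp: FactRing_def A_RCOSETS_defs a_r_coset_def)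
  qed
qed

context valuation_ring
begin

text \<open>
  A proper ideal has no units, so the numerators of its elements lie in \<open>P\<close>, where every denominator
  can be divided out.
\<close>

lemma ideal_covering_hom_localization_at:
  assumes prime: "primeideal P R"
  shows "ideal_covering_hom R (localization_at R P) (\<lambda>a. fraction R (carrier R - P) a \<one>)"
proof -
  interpret P: primeideal P R by fact
  interpret loc: localized_cring R "carrier R - P" by (rule localized_cring_prime[OF prime])
  interpret hom: ring_hom_cring R loc.RS "\<lambda>a. loc.frac a \<one>" by (rule loc.localization_hom)
  have "ideal_covering_hom R loc.RS (\<lambda>a. loc.frac a \<one>)"
  proof
    fix A assume "ideal A loc.RS" and proper: "A \<noteq> carrier loc.RS"
    interpret A: ideal A loc.RS by fact
    show "A \<subseteq> (\<lambda>a. loc.frac a \<one>) ` carrier R"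
    proof
      fix y assume y: "y \<in> A"
      obtain a s where as: "y = loc.frac a s" "a \<in> carrier R" "s \<in> carrier R - P"
        using loc.localizationE[OF A.Icarr[OF y]] by metis
      have "a \<in> P"
      proof (rule ccontr)
        assume "a \<notin> P"
        then have a: "a \<in> carrier R - P" using as(2) by blast
        note S = loc.mult_denominator[OF a as(3)]
        have carr: "a \<in> carrier R" "s \<in> carrier R" using a as(3) by auto
        have "loc.frac s a \<otimes>\<^bsub>loc.RS\<^esub> y = loc.frac (s \<otimes> a) (a \<otimes> s)"
          unfolding as(1) by (rule loc.mult_fraction[OF carr(2) a carr(1) as(3)])
        also have "\<dots> = \<one>\<^bsub>loc.RS\<^esub>"
          unfolding loc.one_localization
          by (rule loc.fraction_cong_eq[OF _ S _ loc.one_denominator]) (use carr in \<open>simp_all add: m_comm\<close>)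
        finally have "loc.frac s a \<otimes>\<^bsub>loc.RS\<^esub> y = \<one>\<^bsub>loc.RS\<^esub>" .
        then have "\<one>\<^bsub>loc.RS\<^esub> \<in> A"
          using A.I_l_closed[OF y loc.fraction_closed[OF carr(2) a]] by simp
        then show False using A.one_imp_carrier proper by blast
      qed
      then obtain b where b: "b \<in> P" "a = s \<otimes> b" using prime_divisible[OF prime as(3)] by blast
      have "y = loc.frac b \<one>"
        unfolding as(1)
        by (rule loc.fraction_cong_eq[OF as(2,3) _ loc.one_denominator])
          (use b as P.Icarr in \<open>simp_all add: m_comm\<close>)
      then show "y \<in> (\<lambda>a. loc.frac a \<one>) ` carrier R" using b P.Icarr by blast
    qed
  qed
  then show ?thesis by (simp add: localization_at_def)
qed

theorem maximal_iff_quotient_localization: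
  assumes prime: "primeideal P R"
  shows "maximal_valuation_ring R \<longleftrightarrow>
    maximal_valuation_ring (R Quot P) \<and> maximal_valuation_ring (localization_at R P)"
proof -
  interpret P: primeideal P R by fact
  let ?L = "localization_at R P" and ?S = "carrier R - P"
  interpret loc: localized_cring R ?S by (rule localized_cring_prime[OF prime])
  interpret quot: ideal_covering_hom R "R Quot P" "(+>) P"
    by (rule P.ideal_covering_hom_quotient)
  interpret to_loc: ideal_covering_hom R ?L "\<lambda>a. loc.frac a \<one>"
    by (rule ideal_covering_hom_localization_at[OF prime])
  interpret QP: domain "R Quot P" by (rule P.quotient_is_domain)
  have val_R: "valuation_ring R" by (rule valuation_ring_axioms)
  have val_quot: "valuation_ring (R Quot P)"
    by (rule quot.valuation_ring_codomain[OF val_R QP.one_not_zero])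
  have "\<one>\<^bsub>?L\<^esub> \<noteq> \<zero>\<^bsub>?L\<^esub>"
  proof
    assume "\<one>\<^bsub>?L\<^esub> = \<zero>\<^bsub>?L\<^esub>"
    then have "loc.frac \<one> \<one> = loc.frac \<zero> \<one>"
      unfolding localization_at_def loc.one_localization loc.zero_localization .
    then obtain u where u: "u \<in> ?S" "u \<otimes> (\<one> \<otimes> \<one>) = u \<otimes> (\<zero> \<otimes> \<one>)"
      using loc.fraction_eq_iff[OF one_closed loc.one_denominator zero_closed loc.one_denominator]
      by blast
    then have "u = \<zero>" by simp
    then show False using u(1) P.zero_closed by blast
  qed
  then have val_loc: "valuation_ring ?L"
    by (rule to_loc.valuation_ring_codomain[OF val_R])
  \<comment> \<open>The saturated ideals and the ideals above \<open>P\<close> are contracted from \<open>R\<^sub>P\<close> and \<open>R/P\<close>.\<close>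
  have contract_sat: "saturation R ?S A = to_loc.contraction (loc.extension A)" if "ideal A R" for A
    using loc.fraction_mem_extension_iff[OF that]
    by (auto simp: to_loc.contraction_def saturation_def)
  have ideal_ext: "ideal (loc.extension A) ?L" if "ideal A R" for A
    using loc.ideal_extension[OF that] by (simp add: localization_at_def)
  have "linearly_compact R" if quot_lc: "linearly_compact (R Quot P)" and loc_lc: "linearly_compact ?L"
  proof (rule linearly_compact_if_above_and_saturated[OF prime])
    show "linearly_compact_wrt R (saturation R ?S ` {A. ideal A R})"
      using to_loc.linearly_compact_wrt_contractions[OF loc_lc]
      by (rule linearly_compact_wrt_subset) (use contract_sat ideal_ext in blast)
    have "A \<in> quot.contraction ` {B. ideal B (R Quot P)}" if A: "ideal A R" "P \<subseteq> A" for A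
    proof
      show image: "(+>) P ` A \<in> {B. ideal B (R Quot P)}"
        using ring_ideal_imp_quot_ideal[OF P.is_ideal A(1)] by simp
      have union: "\<Union>((+>) P ` A) = A"
        using ideal_incl_iff[OF P.is_ideal A(1)] A(2) by simp
      have "(+>) P ` A \<subseteq> carrier (R Quot P)"
        using image ideal.Icarr[of "(+>) P ` A"] by blast
      from canonical_proj_vimage_mem_iff[OF P.is_ideal this, unfolded union]
      have mem: "r \<in> A \<longleftrightarrow> P +> r \<in> (+>) P ` A" if "r \<in> carrier R" for r
        using that .
      have "A = {r \<in> carrier R. r \<in> A}" using ideal.Icarr[OF A(1)] by blast
      also have "\<dots> = quot.contraction ((+>) P ` A)"
        unfolding quot.contraction_def by (intro Collect_cong conj_cong refl mem)
      finally show "A = quot.contraction ((+>) P ` A)" .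
    qed
    then show "linearly_compact_wrt R {A. ideal A R \<and> P \<subseteq> A}"
      by (intro linearly_compact_wrt_subset[OF quot.linearly_compact_wrt_contractions[OF quot_lc]])
        blast
  qed
  then show ?thesis
    using val_R val_quot val_loc quot.linearly_compact_codomain to_loc.linearly_compact_codomain
    by (auto simp: maximal_valuation_ring_def maximal_valuation_ring_axioms_def)
qed

end

theorem theorem4p4:
  fixes R (structure)
  assumes "valuation_ring R"
  shows "maximal_valuation_ring R \<longleftrightarrow>
    maximal_valuation_ring (R Quot nilradical R) \<and>
    maximal_valuation_ring (localization_at R (nilradical R))"
  by (rule valuation_ring.maximal_iff_quotient_localization[OF assms
    valuation_ring.primeideal_nilradical[OF assms]])

end
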